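(* Let $n\ge 2$ and let $\lambda_{i,j}$ ($1\le i\le 3$, $1\le j\le n$) be positive real numbers. Suppose the sides $A_2A_3$, $A_3A_1$, $A_1A_2$ (sides number $i=1,2,3$ respectively) of a nondegenerate triangle $A_1A_2A_3$ in the plane are divided at the points $A_{i,1},A_{i,2},\dots,A_{i,n-1}$, $1\le i\le 3$, in the respective ratios $\lambda_{i,1}:\lambda_{i,2}:\dots:\lambda_{i,n}$. Then the ratio of the area of any sub polygon to the area of the whole triangle depends only on the numbers $\lambda_{i,j}$. Explicitly: let $A_1A_2A_3$ and $A_1'A_2'A_3'$ be two nondegenerate triangles whose sides are divided, at points $A_{i,j}$ and $A'_{i,j}$ respectively, in the same ratios $\lambda_{i,1}:\dots:\lambda_{i,n}$ ($1\le i\le 3$). Let $P=P_1P_2\cdots P_m$ be a sub polygon of the first triangle and $P'=P_1'P_2'\cdots P_m'$ a sub polygon of the second triangle such that for every $k$, $P_k$ is the intersection of the distinct cevians $A_{i}A_{i,j}$ and $A_{r}A_{r,s}$ and $P'_k$ is the intersection of the correspondingly indexed cevians $A'_{i}A'_{i,j}$ and $A'_{r}A'_{r,s}$ (the indices $i,j,r,s$ depending on $k$). Then $$\frac{\operatorname{area}(P)}{\operatorname{area}(A_1A_2A_3)}=\frac{\operatorname{area}(P')}{\operatorname{area}(A'_1A'_2A'_3)}.$$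
   Context: Side $1$ is $A_2A_3$ (directed from $A_2$ to $A_3$), side $2$ is $A_3A_1$ (from $A_3$ to $A_1$), side $3$ is $A_1A_2$ (from $A_1$ to $A_2$); so side $i$ is opposite the vertex $A_i$. Saying that a side $XY$ is divided at points $Q_1,\dots,Q_{n-1}$ in the ratios $\lambda_1:\lambda_2:\dots:\lambda_n$ means that $Q_1,\dots,Q_{n-1}$ lie on the segment in this order from $X$ to $Y$ and $|XQ_1|:|Q_1Q_2|:\dots:|Q_{n-1}Y|=\lambda_1:\lambda_2:\dots:\lambda_n$. The cevians are the segments $A_iA_{i,j}$, $1\le i\le 3$, $1\le j\le n-1$. A sub polygon of the triangle is a (simple) polygon whose vertices are points of intersection of these cevians. *)

theory Defs
  imports "HOL-Analysis.Analysis"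
begin

definition area :: "(real^2) set \<Rightarrow> real" where
  "area S = measure lebesgue S"

subsection \<open>Divided sides and cevians\<close>

text \<open>
  A triangle is given by its vertices \<open>A 1\<close>, \<open>A 2\<close>, \<open>A 3\<close>; other values of \<open>A\<close> are irrelevant.
  Likewise, only \<open>Q 1, ..., Q (n - 1)\<close> and \<open>lam 1, ..., lam n\<close> matter below.
\<close>

definition nondegenerate_triangle :: "(nat \<Rightarrow> real^2) \<Rightarrow> bool" where
  "nondegenerate_triangle A \<longleftrightarrow> \<not> collinear {A 1, A 2, A 3}"

definition triangle_region :: "(nat \<Rightarrow> real^2) \<Rightarrow> (real^2) set" where
  "triangle_region A = convex hull {A 1, A 2, A 3}"

definition with_endpoints :: "real^2 \<Rightarrow> real^2 \<Rightarrow> nat \<Rightarrow> (nat \<Rightarrow> real^2) \<Rightarrow> nat \<Rightarrow> real^2" where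
  "with_endpoints X Y n Q j = (if j = 0 then X else if j = n then Y else Q j)"

text \<open>
  On a segment starting at \<open>X\<close>, being ordered from \<open>X\<close> to \<open>Y\<close> means having increasing
  distance from \<open>X\<close>.  The last clause says that the consecutive distances
  \<open>|X Q\<^sub>1|, |Q\<^sub>1 Q\<^sub>2|, ..., |Q\<^bsub>n-1\<^esub> Y|\<close> are proportional to \<open>lam 1, ..., lam n\<close>.
\<close>

definition divides_in_ratios ::
    "real^2 \<Rightarrow> real^2 \<Rightarrow> nat \<Rightarrow> (nat \<Rightarrow> real) \<Rightarrow> (nat \<Rightarrow> real^2) \<Rightarrow> bool" where
  "divides_in_ratios X Y n lam Q \<longleftrightarrow>
     (\<forall>j\<in>{1..n-1}. Q j \<in> closed_segment X Y) \<and>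
     (\<forall>j\<in>{1..n-1}. \<forall>k\<in>{1..n-1}. j < k \<longrightarrow> dist X (Q j) < dist X (Q k)) \<and>
     (\<exists>c>0. \<forall>j\<in>{1..n}.
        dist (with_endpoints X Y n Q (j - 1)) (with_endpoints X Y n Q j) = c * lam j)"

definition sides_divided ::
    "(nat \<Rightarrow> real^2) \<Rightarrow> nat \<Rightarrow> (nat \<Rightarrow> nat \<Rightarrow> real) \<Rightarrow> (nat \<Rightarrow> nat \<Rightarrow> real^2) \<Rightarrow> bool" where
  "sides_divided A n lam D \<longleftrightarrow>
     divides_in_ratios (A 2) (A 3) n (lam 1) (D 1) \<and>
     divides_in_ratios (A 3) (A 1) n (lam 2) (D 2) \<and>
     divides_in_ratios (A 1) (A 2) n (lam 3) (D 3)"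

definition cevian ::
    "(nat \<Rightarrow> real^2) \<Rightarrow> (nat \<Rightarrow> nat \<Rightarrow> real^2) \<Rightarrow> nat \<times> nat \<Rightarrow> (real^2) set" where
  "cevian A D = (\<lambda>(i, j). closed_segment (A i) (D i j))"

definition cevian_indices :: "nat \<Rightarrow> (nat \<times> nat) set" where
  "cevian_indices n = {1..3} \<times> {1..n-1}"

subsection \<open>Simple polygons\<close>

fun polygonal_path :: "(real^2) list \<Rightarrow> real \<Rightarrow> real^2" where
  "polygonal_path [] = linepath 0 0"
| "polygonal_path [a] = linepath a a"
| "polygonal_path [a, b] = linepath a b"
| "polygonal_path (a # b # c # xs) = linepath a b +++ polygonal_path (b # c # xs)"

definition polygon_path :: "(real^2) list \<Rightarrow> real \<Rightarrow> real^2" where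
  "polygon_path ps = polygonal_path (ps @ [hd ps])"

text \<open>
  The closed path is simple: distinct parameters give distinct points, apart from the common
  start and end point.  Straight angles at vertices are allowed.
\<close>

definition simple_polygon :: "(real^2) list \<Rightarrow> bool" where
  "simple_polygon ps \<longleftrightarrow> length ps \<ge> 3 \<and> simple_path (polygon_path ps)"

definition polygon_region :: "(real^2) list \<Rightarrow> (real^2) set" where
  "polygon_region ps = path_image (polygon_path ps) \<union> inside (path_image (polygon_path ps))"

definition sub_polygon ::
    "(nat \<Rightarrow> real^2) \<Rightarrow> nat \<Rightarrow> (nat \<Rightarrow> nat \<Rightarrow> real^2) \<Rightarrow> (real^2) list \<Rightarrow> bool" where
  "sub_polygon A n D ps \<longleftrightarrow>
     simple_polygon ps \<and>
     (\<forall>p\<in>set ps. \<exists>c\<in>cevian_indices n. \<exists>d\<in>cevian_indices n.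
        c \<noteq> d \<and> cevian A D c \<inter> cevian A D d = {p})"

end

theory Submission imports Defs begin

text \<open>
  The affine map taking one triangle to the other takes each division point to the
  corresponding one, because a division point has barycentric coordinates that depend only on the
  ratios.  Hence it takes cevians to cevians and one sub polygon to the other, and an affine map
  multiplies all areas by the same nonzero factor.
\<close>

section \<open>Affine images of segments and polygonal paths\<close>

lemma affine_linepath:
  fixes f :: "'a::real_normed_vector \<Rightarrow> 'b::real_normed_vector"
  assumes "linear f"
  shows "b + f (linepath x y t) = linepath (b + f x) (b + f y) t"
  using assms by (simp add: linepath_def linear_add linear_diff linear_scale algebra_simps)

lemma affine_image_closed_segment:
  fixes f :: "'a::real_normed_vector \<Rightarrow> 'b::real_normed_vector"
  assumes "linear f"
  shows "(\<lambda>x. b + f x) ` closed_segment x y = closed_segment (b + f x) (b + f y)"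
proof -
  have "(\<lambda>x. b + f x) ` linepath x y ` {0..1} = linepath (b + f x) (b + f y) ` {0..1}"
    unfolding image_image affine_linepath[OF assms] ..
  then show ?thesis
    using path_image_linepath by (metis path_image_def)
qed

lemma affine_convex_hull:
  assumes "linear f"
  shows "convex hull ((\<lambda>x. b + f x) ` S) = (\<lambda>x. b + f x) ` (convex hull S)"
  using convex_hull_translation[of b "f ` S"] convex_hull_linear_image[OF assms, of S]
  by (simp add: image_image[of _ f, symmetric])

text \<open>The path is built from \<open>linepath\<close> and \<open>+++\<close>, and an affine map
  commutes with both. The empty list is excluded because its path is constantly \<open>0\<close>, a
  point that the map moves whenever \<open>b\<close> is nonzero.\<close>

lemma polygonal_path_affine:
  assumes "linear f" "ps \<noteq> []"
  shows "polygonal_path (map (\<lambda>x. b + f x) ps) = (\<lambda>x. b + f x) \<circ> polygonal_path ps"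
  using assms(2)
proof (induction ps rule: polygonal_path.induct)
  case (4 p q r ps)
  have "(\<lambda>x. b + f x) \<circ> polygonal_path (p # q # r # ps)
      = ((\<lambda>x. b + f x) \<circ> linepath p q) +++ ((\<lambda>x. b + f x) \<circ> polygonal_path (q # r # ps))"
    by (simp add: path_compose_join)
  moreover have "(\<lambda>x. b + f x) \<circ> linepath p q = linepath (b + f p) (b + f q)"
    using affine_linepath[OF assms(1)] by (auto simp: fun_eq_iff)
  ultimately show ?case
    using 4 by (simp del: o_apply)
qed (simp_all add: fun_eq_iff affine_linepath[OF assms(1)])

lemma polygon_path_affine:
  assumes "linear f" "ps \<noteq> []"
  shows "polygon_path (map (\<lambda>x. b + f x) ps) = (\<lambda>x. b + f x) \<circ> polygon_path ps"
  using polygonal_path_affine[OF assms(1), of "ps @ [hd ps]" b] assms(2)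
  by (simp add: polygon_path_def hd_map)

section \<open>The inside of a set under a homeomorphism of the whole space\<close>

lemma inside_homeomorphism_image_subset:
  fixes T :: "'a::euclidean_space \<Rightarrow> 'a"
  assumes "homeomorphism UNIV UNIV T U"
  shows "T ` inside S \<subseteq> inside (T ` S)"
proof
  fix y assume "y \<in> T ` inside S"
  then obtain x where x: "x \<notin> S" "bounded (connected_component_set (- S) x)" and y: "y = T x"
    by (auto simp: inside_def)
  have UT: "U (T x) = x" and TU: "T (U x) = x" for x
    using assms by (auto simp: homeomorphism_def)
  have cT: "continuous_on X T" and cU: "continuous_on X U" for X
    using homeomorphism_cont1[OF assms] homeomorphism_cont2[OF assms]
    by (simp_all add: continuous_on_subset[OF _ subset_UNIV])
  have "T x \<notin> T ` S"
    using x(1) UT by (metis imageE)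
  \<comment> \<open>Since \<open>T\<close> is a bijection of the whole space, it restricts to the
    complements, and so carries the component of \<open>x\<close> onto the component of
    \<open>T x\<close>.\<close>
  moreover have "homeomorphism (- S) (- (T ` S)) T U"
    unfolding homeomorphism_def
  proof (intro conjI ballI)
    show "T ` (- S) = - T ` S"
    proof (intro equalityI subsetI)
      fix z assume "z \<in> - T ` S"
      then have "U z \<in> - S" "z = T (U z)"
        using TU by (metis ComplD ComplI imageI)+
      then show "z \<in> T ` (- S)"
        by blast
    next
      fix z assume "z \<in> T ` (- S)"
      then obtain w where "z = T w" "w \<notin> S"
        by auto
      then show "z \<in> - T ` S"
        using UT by (metis ComplI imageE)
    qed
    then have "U ` (- T ` S) = U ` T ` (- S)"
      by simp
    then show "U ` (- T ` S) = - S"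
      by (simp add: image_image UT)
  qed (simp_all add: UT TU cT cU)
  then have "connected_component_set (- (T ` S)) (T x) = T ` connected_component_set (- S) x"
    using x(1) by (intro connected_component_set_homeomorphism) simp_all
  \<comment> \<open>Boundedness is not a topological property. The component is therefore enclosed
    in its closure, which is compact and has a compact image.\<close>
  moreover have "bounded (T ` connected_component_set (- S) x)"
  proof (rule bounded_subset)
    have "compact (closure (connected_component_set (- S) x))"
      using x(2) by (simp add: compact_closure)
    then show "bounded (T ` closure (connected_component_set (- S) x))"
      using cT by (intro compact_imp_bounded compact_continuous_image)
  qed (intro image_mono closure_subset)
  ultimately show "y \<in> inside (T ` S)"
    using y by (simp add: inside_def)
qed

lemma inside_homeomorphism_image:
  fixes T :: "'a::euclidean_space \<Rightarrow> 'a"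
  assumes "homeomorphism UNIV UNIV T U"
  shows "inside (T ` S) = T ` inside S"
proof
  have "U ` inside (T ` S) \<subseteq> inside (U ` T ` S)"
    using inside_homeomorphism_image_subset homeomorphism_symD[OF assms] by blast
  moreover have "U ` T ` S = S" "T ` U ` inside (T ` S) = inside (T ` S)"
    using assms by (auto simp: homeomorphism_def image_image)
  ultimately show "inside (T ` S) \<subseteq> T ` inside S"
    by (metis image_mono)
qed (rule inside_homeomorphism_image_subset[OF assms])

text \<open>In finite dimension an injective linear endomorphism has a two-sided linear inverse
  \<open>g\<close>; undoing the translation first gives the inverse
  \<open>g (y - b)\<close>.\<close>

lemma affine_homeomorphism:
  fixes f :: "'a::euclidean_space \<Rightarrow> 'a"
  assumes "linear f" "inj f"
  obtains U where "homeomorphism UNIV UNIV (\<lambda>x. b + f x) U"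
proof -
  obtain g where g: "linear g" "\<And>x. g (f x) = x" "\<And>x. f (g x) = x"
    using linear_injective_isomorphism[OF assms] by auto
  have "homeomorphism UNIV UNIV (\<lambda>x. b + f x) (\<lambda>y. g (y - b))"
    by (rule homeomorphismI)
       (auto intro!: continuous_intros linear_continuous_on_compose[OF _ assms(1)]
          linear_continuous_on_compose[OF _ g(1)] simp: g)
  then show thesis ..
qed

lemma polygon_region_affine:
  assumes "linear f" "inj f" "ps \<noteq> []"
  shows "polygon_region (map (\<lambda>x. b + f x) ps) = (\<lambda>x. b + f x) ` polygon_region ps"
proof -
  obtain U where "homeomorphism UNIV UNIV (\<lambda>x. b + f x) U"
    using affine_homeomorphism[OF assms(1,2)] .
  then show ?thesis
    by (simp add: polygon_region_def polygon_path_affine[OF assms(1,3)] path_image_compose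
        inside_homeomorphism_image image_Un)
qed

section \<open>Measurability and scaling of areas\<close>

lemma path_polygonal_path:
  "path (polygonal_path ps) \<and> (ps \<noteq> [] \<longrightarrow> pathstart (polygonal_path ps) = hd ps)"
  \<comment> \<open>The start point is tracked because the induction joins
    \<open>linepath a b\<close> to the rest, which must then begin at \<open>b\<close>.\<close>
  by (induction ps rule: polygonal_path.induct) (auto, auto simp: path_def pathstart_def)

text \<open>The boundary is compact, being the image of a path, and the inside of a compact set is
  open and bounded.\<close>

lemma lmeasurable_polygon_region: "polygon_region ps \<in> lmeasurable"
proof -
  have c: "compact (path_image (polygon_path ps))"
    using path_polygonal_path by (simp add: polygon_path_def compact_path_image)
  then have "inside (path_image (polygon_path ps)) \<in> lmeasurable"
    by (intro lmeasurable_open bounded_inside open_inside) (auto simp: compact_imp_closed compact_imp_bounded)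
  then show ?thesis
    unfolding polygon_region_def using c by (intro fmeasurable.Un[OF lmeasurable_compact])
qed

lemma area_affine_image:
  assumes "linear f" "S \<in> lmeasurable"
  shows "area ((\<lambda>x. b + f x) ` S) = \<bar>det (matrix f)\<bar> * area S"
  using measure_translation[of b "f ` S"] measure_linear_image[OF assms]
  by (simp add: area_def image_image)

section \<open>The affine map between two triangles\<close>

lemma spanning_pair_if_not_collinear:
  fixes u v :: "real^2"
  assumes "\<not> collinear {0, u, v}"
  shows "independent {u, v}" "span {u, v} = UNIV" "u \<noteq> v"
proof -
  show "u \<noteq> v"
    using assms by auto
  have "u \<noteq> 0" "v \<noteq> 0" "\<And>c. v \<noteq> c *\<^sub>R u"
    using assms by (auto simp: collinear_lemma)
  then have "independent {v, u}"
    by (auto simp: independent_insert span_singleton)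
  then show ind: "independent {u, v}"
    by (simp add: insert_commute)
  have "UNIV \<subseteq> span {u, v}"
    using ind \<open>u \<noteq> v\<close> by (intro card_ge_dim_independent) auto
  then show "span {u, v} = UNIV"
    by auto
qed

text \<open>The values on the basis \<open>u\<close>, \<open>v\<close> can be prescribed. The image
  then contains the spanning pair \<open>u'\<close>, \<open>v'\<close>, so the map is onto, hence
  injective by dimension.\<close>

lemma linear_isomorphism_pair:
  fixes u v u' v' :: "real^2"
  assumes "\<not> collinear {0, u, v}" "\<not> collinear {0, u', v'}"
  obtains f where "linear f" "inj f" "f u = u'" "f v = v'"
proof -
  note uv = spanning_pair_if_not_collinear[OF assms(1)]
  note uv' = spanning_pair_if_not_collinear[OF assms(2)]
  obtain f where f: "linear f" "f u = u'" "f v = v'"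
    using linear_independent_extend[OF uv(1), of "\<lambda>x. if x = u then u' else v'"] uv(3) by auto
  have "f ` span {u, v} = span {u', v'}"
    using f linear_span_image[OF f(1), of "{u, v}"] by simp
  then have "surj f"
    using uv(2) uv'(2) by simp
  then show thesis
    using that f linear_surjective_imp_injective by blast
qed

text \<open>The linear part is prescribed on the two edge vectors at \<open>A 1\<close>. The
  translation \<open>A' 1 - f (A 1)\<close> matches the first vertices, and the other two
  follow.\<close>

lemma affine_map_between_triangles:
  assumes "nondegenerate_triangle A" "nondegenerate_triangle A'"
  obtains f b where "linear f" "inj f" "\<And>i. i \<in> {1..3} \<Longrightarrow> A' i = b + f (A i)"
proof -
  have nc: "\<not> collinear {0, A 2 - A 1, A 3 - A 1}" if "nondegenerate_triangle A"
    for A :: "nat \<Rightarrow> real^2"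
  proof -
    \<comment> \<open>\<open>collinear_3\<close> takes the middle point as the origin, hence the
      order with \<open>A 1\<close> in the middle.\<close>
    have "collinear {A 2, A 1, A 3} \<longleftrightarrow> collinear {0, A 2 - A 1, A 3 - A 1}"
      by (rule collinear_3) simp
    then show ?thesis
      using that by (simp add: nondegenerate_triangle_def insert_commute)
  qed
  obtain f where f: "linear f" "inj f"
    "f (A 2 - A 1) = A' 2 - A' 1" "f (A 3 - A 1) = A' 3 - A' 1"
    using linear_isomorphism_pair[OF nc nc] assms by metis
  show thesis
  proof (rule that[OF f(1,2)])
    fix i :: nat assume "i \<in> {1..3}"
    then have "i = 1 \<or> i = 2 \<or> i = 3"
      by auto
    then show "A' i = (A' 1 - f (A 1)) + f (A i)"
      using f(3,4) by (auto simp: linear_diff[OF f(1)] algebra_simps)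
  qed
qed

section \<open>Position of the division points on a side\<close>

lemma division_point_formula:
  assumes "divides_in_ratios X Y n lam Q" "X \<noteq> Y" "n \<ge> 1" "j \<in> {1..n-1}"
  shows "Q j = X + (sum lam {1..j} / sum lam {1..n}) *\<^sub>R (Y - X)"
proof -
  \<comment> \<open>With the endpoints included as \<open>E 0\<close> and \<open>E n\<close>, all
    \<open>n\<close> gaps are treated alike; \<open>t k\<close> below is the parameter of
    \<open>E k\<close> on the segment.\<close>
  define E where "E = with_endpoints X Y n Q"
  have seg: "\<exists>t. 0 \<le> t \<and> t \<le> 1 \<and> E k = X + t *\<^sub>R (Y - X)" if "k \<le> n" for k
  proof -
    have "E k \<in> closed_segment X Y"
      using assms(1) that by (auto simp: divides_in_ratios_def E_def with_endpoints_def)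
    then show ?thesis
      by (auto simp: in_segment algebra_simps)
  qed
  then obtain t where t: "\<And>k. k \<le> n \<Longrightarrow> 0 \<le> t k \<and> t k \<le> 1 \<and> E k = X + t k *\<^sub>R (Y - X)"
    by metis
  have E0: "E 0 = X" and En: "E n = Y"
    using assms(3) by (auto simp: E_def with_endpoints_def)
  have d: "dist X Y > 0"
    using assms(2) by simp
  have t0: "t 0 = 0"
    using t[of 0] E0 assms(2) by simp
  have "(1 - t n) *\<^sub>R (Y - X) = 0"
    using t[of n] En by (simp add: algebra_simps)
  then have tn: "t n = 1"
    using assms(2) by simp
  have dX: "dist X (E k) = t k * dist X Y" if "k \<le> n" for k
    using t[OF that] by (simp add: dist_norm norm_minus_commute)
  \<comment> \<open>The order hypothesis concerns interior points only. In a gap touching an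
    endpoint, \<open>0 \<le> t k \<le> 1\<close> suffices.\<close>
  have mono: "t k \<le> t (Suc k)" if "k < n" for k
  proof (cases "k = 0 \<or> Suc k = n")
    case True
    then show ?thesis
      using t[of k] t[of "Suc k"] t0 tn that by auto
  next
    case False
    then have "k \<in> {1..n-1}" "Suc k \<in> {1..n-1}"
      using that by auto
    then have "dist X (Q k) < dist X (Q (Suc k))"
      using assms(1) unfolding divides_in_ratios_def by blast
    then have "t k * dist X Y < t (Suc k) * dist X Y"
      using False that dX[of k] dX[of "Suc k"] by (auto simp: E_def with_endpoints_def)
    then show ?thesis
      using d by simp
  qed
  obtain c where c: "\<forall>k\<in>{1..n}. dist (E (k - 1)) (E k) = c * lam k"
    using assms(1) unfolding divides_in_ratios_def E_def by blast
  \<comment> \<open>A distance gives only the absolute value of a parameter difference;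
    \<open>mono\<close> supplies the sign.\<close>
  have step: "(t (Suc k) - t k) * dist X Y = c * lam (Suc k)" if "k < n" for k
  proof -
    have "E k - E (Suc k) = (t k - t (Suc k)) *\<^sub>R (Y - X)"
      using t[of k] t[of "Suc k"] that by (simp add: scaleR_diff_left)
    then have "dist (E k) (E (Suc k)) = (t (Suc k) - t k) * dist X Y"
      using mono[OF that] by (simp add: dist_norm norm_minus_commute)
    then show ?thesis
      using c that by (metis Suc_leI atLeastAtMost_iff diff_Suc_1 le_add1 plus_1_eq_Suc)
  qed
  \<comment> \<open>The gaps telescope from \<open>t 0 = 0\<close>. The case \<open>k = n\<close>
    expresses the whole length through \<open>c\<close>, which then cancels.\<close>
  have S: "t k * dist X Y = c * sum lam {1..k}" if "k \<le> n" for k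
    using that
  proof (induction k)
    case (Suc k)
    then show ?case
      using step[of k] by (simp add: algebra_simps)
  qed (simp add: t0)
  have n: "dist X Y = c * sum lam {1..n}"
    using S[of n] tn by simp
  then have "t j = sum lam {1..j} / sum lam {1..n}"
  proof -
    have "t j * (c * sum lam {1..n}) = c * sum lam {1..j}"
      using S[of j] n assms(4) by auto
    moreover have "c \<noteq> 0" "sum lam {1..n} \<noteq> 0"
      using n d by auto
    ultimately show ?thesis
      by (simp add: field_simps)
  qed
  moreover have "0 < j" "j < n"
    using assms(4) by auto
  ultimately show ?thesis
    using t[of j] by (simp add: E_def with_endpoints_def)
qed

section \<open>Transport of division points and cevians\<close>

lemma nondegenerate_triangle_distinct:
  assumes "nondegenerate_triangle A"
  shows "A 1 \<noteq> A 2" "A 2 \<noteq> A 3" "A 3 \<noteq> A 1"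
  using assms by (auto simp: nondegenerate_triangle_def insert_commute)

text \<open>Both points have the parameter \<open>sum lam {1..j} / sum lam {1..n}\<close> on their
  sides, and an affine map preserves parameters on segments.\<close>

lemma division_point_affine:
  assumes "linear f" "divides_in_ratios X Y n lam Q"
    and "divides_in_ratios (b + f X) (b + f Y) n lam Q'"
    and "X \<noteq> Y" "b + f X \<noteq> b + f Y" "n \<ge> 1" "j \<in> {1..n-1}"
  shows "Q' j = b + f (Q j)"
  using division_point_formula[OF assms(2,4,6,7)] division_point_formula[OF assms(3,5,6,7)] assms(1)
  by (simp add: linear_add linear_diff linear_scale)

lemma cevian_affine:
  assumes "linear f" "\<And>i. i \<in> {1..3} \<Longrightarrow> A' i = b + f (A i)"
    and "nondegenerate_triangle A" "nondegenerate_triangle A'"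
    and "sides_divided A n lam D" "sides_divided A' n lam D'"
    and "n \<ge> 1" "c \<in> cevian_indices n"
  shows "cevian A' D' c = (\<lambda>x. b + f x) ` cevian A D c"
proof -
  obtain i j where c: "c = (i, j)" "i \<in> {1..3}" "j \<in> {1..n-1}"
    using assms(8) by (auto simp: cevian_indices_def)
  note ne = nondegenerate_triangle_distinct[OF assms(3)]
    nondegenerate_triangle_distinct[OF assms(4)]
  have A': "A' 1 = b + f (A 1)" "A' 2 = b + f (A 2)" "A' 3 = b + f (A 3)"
    using assms(2) by auto
  note side = division_point_affine[OF assms(1) _ _ _ _ assms(7) c(3)]
  have div: "divides_in_ratios (A 2) (A 3) n (lam 1) (D 1)"
    "divides_in_ratios (A 3) (A 1) n (lam 2) (D 2)"
    "divides_in_ratios (A 1) (A 2) n (lam 3) (D 3)"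
    and div': "divides_in_ratios (b + f (A 2)) (b + f (A 3)) n (lam 1) (D' 1)"
    "divides_in_ratios (b + f (A 3)) (b + f (A 1)) n (lam 2) (D' 2)"
    "divides_in_ratios (b + f (A 1)) (b + f (A 2)) n (lam 3) (D' 3)"
    using assms(5,6) unfolding sides_divided_def A' by blast+
  have "D' 1 j = b + f (D 1 j)"
    by (rule side[OF div(1) div'(1) ne(2) ne(5)[unfolded A']])
  moreover have "D' 2 j = b + f (D 2 j)"
    by (rule side[OF div(2) div'(2) ne(3) ne(6)[unfolded A']])
  moreover have "D' 3 j = b + f (D 3 j)"
    by (rule side[OF div(3) div'(3) ne(1) ne(4)[unfolded A']])
  moreover have "i = 1 \<or> i = 2 \<or> i = 3"
    using c(2) by auto
  ultimately have "D' i j = b + f (D i j)"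
    by (elim disjE) (simp_all only:)
  then show ?thesis
    using assms(2)[OF c(2)] by (simp add: c(1) cevian_def affine_image_closed_segment[OF assms(1)])
qed

section \<open>Matching the sub polygons and comparing areas\<close>

theorem theorem2:
  fixes n :: nat
    and lam :: "nat \<Rightarrow> nat \<Rightarrow> real"
    and A A' :: "nat \<Rightarrow> real^2"
    and D D' :: "nat \<Rightarrow> nat \<Rightarrow> real^2"
    and P P' :: "(real^2) list"
  assumes "n \<ge> 2"
    and "\<And>i j. i \<in> {1..3} \<Longrightarrow> j \<in> {1..n} \<Longrightarrow> lam i j > 0"
    and "nondegenerate_triangle A" and "nondegenerate_triangle A'"
    and "sides_divided A n lam D" and "sides_divided A' n lam D'"
    and "sub_polygon A n D P" and "sub_polygon A' n D' P'"
    and "length P = length P'"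
    and "\<And>k. k < length P \<Longrightarrow>
           \<exists>c\<in>cevian_indices n. \<exists>d\<in>cevian_indices n. c \<noteq> d \<and>
             cevian A D c \<inter> cevian A D d = {P ! k} \<and>
             cevian A' D' c \<inter> cevian A' D' d = {P' ! k}"
  shows "area (polygon_region P) / area (triangle_region A) =
         area (polygon_region P') / area (triangle_region A')"
proof -
  obtain f b where f: "linear f" "inj f" and A': "\<And>i. i \<in> {1..3} \<Longrightarrow> A' i = b + f (A i)"
    using affine_map_between_triangles[OF assms(3,4)] by blast
  let ?T = "\<lambda>x. b + f x"
  have "inj ?T"
    using f(2) by (auto simp: inj_def)
  have cev: "cevian A' D' c = ?T ` cevian A D c" if "c \<in> cevian_indices n" for c
    using cevian_affine[OF f(1) A' assms(3-6) _ that] assms(1) by simp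
  have vertex: "P' ! k = ?T (P ! k)" if k: "k < length P" for k
  proof -
    obtain c d where cd: "c \<in> cevian_indices n" "d \<in> cevian_indices n"
      "cevian A D c \<inter> cevian A D d = {P ! k}" "cevian A' D' c \<inter> cevian A' D' d = {P' ! k}"
      using assms(10)[OF k] by blast
    \<comment> \<open>Injectivity of the map makes the image of the intersection equal to the
      intersection of the images, so the single common points correspond.\<close>
    have "{P' ! k} = ?T ` (cevian A D c \<inter> cevian A D d)"
      using cd(4) by (simp only: cev[OF cd(1)] cev[OF cd(2)] image_Int[OF \<open>inj ?T\<close>])
    then show ?thesis
      by (simp add: cd(3))
  qed
  have P': "P' = map ?T P"
    using assms(9) vertex by (auto intro: nth_equalityI)
  have "P \<noteq> []"
    using assms(7) by (auto simp: sub_polygon_def simple_polygon_def)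
  then have "area (polygon_region P') = \<bar>det (matrix f)\<bar> * area (polygon_region P)"
    unfolding P' by (simp add: polygon_region_affine f area_affine_image lmeasurable_polygon_region)
  moreover have "triangle_region A' = ?T ` triangle_region A"
    using affine_convex_hull[OF f(1), of b "{A 1, A 2, A 3}"] A' by (simp add: triangle_region_def)
  then have "area (triangle_region A') = \<bar>det (matrix f)\<bar> * area (triangle_region A)"
    by (simp add: triangle_region_def area_affine_image f(1) lmeasurable_compact
        finite_imp_compact_convex_hull)
  \<comment> \<open>The common factor is nonzero, so it cancels between numerator and
    denominator.\<close>
  moreover have "det (matrix f) \<noteq> 0"
    using det_nz_iff_inj f by blast
  ultimately show ?thesis
    by simp
qed

end
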